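(* Let $R$ be a finite Frobenius ring and $w$ a homogeneous weight on $R$ with average value $\gamma$, extended additively to $R^n$. Let $C\leq {}_RR^n$ be a nonzero linear code of length $n$ and minimum homogeneous weight $d$ satisfying $\gamma n<d$, and let $c\in C$ be such that $\gamma\,\ell(c)<d$. Then $$|C|\;\leq\;|Rc|\,\frac{d-\gamma\,\ell(c)}{d-\gamma n}.$$
   Context: A finite ring $R$ (with identity) is Frobenius if the character group of $(R,+)$ is isomorphic to $R$ as a left $R$-module (equivalently, $R$ has a character whose kernel contains no nonzero left or right ideal). A function $w:R\to\mathbb{R}$ is a homogeneous weight with average value $\gamma$ if $w(0)=0$, $w(x)=w(y)$ whenever $Rx=Ry$, and $\sum_{y\in Rx} w(y)=\gamma|Rx|$ for all nonzero $x\in R$; on $R^n$, $w(c)=\sum_i w(c_i)$. Minimum homogeneous weight of a code is the minimum of $w$ over its nonzero words. For $c\in R^n$, $\ell(c)$ denotes the Hamming weight, i.e. the number of nonzero coordinates of $c$. *)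

theory Defs
  imports "HOL-Analysis.Analysis"
begin

text \<open>
  Rings are given by the class \<^class>\<open>ring_1\<close>, so multiplication need not be commutative.
  The algebraic notions below are spelled out because the module theories of the library
  assume commutative scalars.
\<close>

definition additive_character :: "('a::ring_1 \<Rightarrow> complex) \<Rightarrow> bool" where
  "additive_character \<psi> \<longleftrightarrow>
     (\<forall>x. \<psi> x \<noteq> 0) \<and> (\<forall>x y. \<psi> (x + y) = \<psi> x * \<psi> y)"

text \<open>
  The character group is written multiplicatively (pointwise product), and \<open>r\<close> acts on
  it from the left by sending \<open>\<psi>\<close> to the character \<open>y \<mapsto> \<psi> (y r)\<close>. The map \<open>\<Phi>\<close> is an
  isomorphism of left modules from the ring to its character group.
\<close>

definition frobenius_ring :: "'a::{ring_1,finite} itself \<Rightarrow> bool" where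
  "frobenius_ring TYPE('a) \<longleftrightarrow>
     (\<exists>\<Phi> :: 'a \<Rightarrow> 'a \<Rightarrow> complex.
        bij_betw \<Phi> UNIV {\<psi>. additive_character \<psi>} \<and>
        (\<forall>x y. \<Phi> (x + y) = (\<lambda>z. \<Phi> x z * \<Phi> y z)) \<and>
        (\<forall>r x. \<Phi> (r * x) = (\<lambda>y. \<Phi> x (y * r))))"

definition left_ideal_gen :: "'a::ring_1 \<Rightarrow> 'a set" where
  "left_ideal_gen x = range (\<lambda>r. r * x)"

definition homogeneous_weight :: "real \<Rightarrow> ('a::{ring_1,finite} \<Rightarrow> real) \<Rightarrow> bool" where
  "homogeneous_weight \<gamma> w \<longleftrightarrow>
     w 0 = 0 \<and>
     (\<forall>x y. left_ideal_gen x = left_ideal_gen y \<longrightarrow> w x = w y) \<and>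
     (\<forall>x. x \<noteq> 0 \<longrightarrow>
        (\<Sum>y\<in>left_ideal_gen x. w y) = \<gamma> * real (card (left_ideal_gen x)))"

definition word_weight :: "('a \<Rightarrow> real) \<Rightarrow> 'a ^ 'n \<Rightarrow> real" where
  "word_weight w c = (\<Sum>i\<in>UNIV. w (c $ i))"

definition hamming_weight :: "('a::zero) ^ 'n \<Rightarrow> nat" where
  "hamming_weight c = card {i. c $ i \<noteq> 0}"

definition left_linear_code :: "(('a::ring_1) ^ 'n) set \<Rightarrow> bool" where
  "left_linear_code C \<longleftrightarrow>
     0 \<in> C \<and> (\<forall>x\<in>C. \<forall>y\<in>C. x + y \<in> C) \<and> (\<forall>r. \<forall>x\<in>C. r *s x \<in> C)"

definition left_submodule_gen :: "('a::ring_1) ^ 'n \<Rightarrow> ('a ^ 'n) set" where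
  "left_submodule_gen c = range (\<lambda>r. r *s c)"

text \<open>Only meaningful if \<open>C\<close> contains a nonzero word, since \<^const>\<open>Min\<close> is unspecified on \<open>{}\<close>.\<close>

definition min_word_weight :: "('a \<Rightarrow> real) \<Rightarrow> (('a::{ring_1,finite}) ^ 'n) set \<Rightarrow> real" where
  "min_word_weight w C = Min (word_weight w ` (C - {0}))"

end

theory Submission
  imports Defs
begin

text \<open>
  If \<open>\<psi>\<close> is the character corresponding to \<open>1\<close> and \<open>U\<close> is the group of units, then
  \<open>w x = \<gamma> (1 - avg\<^sub>u \<psi> (u x))\<close>: both sides agree because a homogeneous weight is determined by
  induction on \<open>|Rx|\<close>, and the right-hand side is constant on generators of \<open>Rx\<close> because \<open>U\<close> acts
  transitively on them. Hence \<open>w\<close> has average \<open>\<gamma>\<close> on every coset of a nonzero left ideal. For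
  \<open>x \<in> C - Rc\<close>, averaging over \<open>x + Rc\<close> shows that the part of \<open>x\<close> outside the support of \<open>c\<close>
  has weight at least \<open>d - \<gamma> \<ell>(c)\<close>; on \<open>Rc\<close> this part vanishes. Summing over \<open>C\<close>, where each
  coordinate contributes at most \<open>\<gamma> |C|\<close>, gives the bound. A coordinate on which \<open>C\<close> vanishes
  contributes \<open>0\<close>, so this needs \<open>\<gamma> \<ge> 0\<close>, which is forced by the hypotheses: averaging over \<open>Rx\<close>
  for a suitable nonzero \<open>x \<in> C\<close> contradicts \<open>\<gamma> \<ell>(x) < d\<close> if \<open>\<gamma> < 0\<close>.
\<close>

section \<open>Units and generators of principal left ideals\<close>

definition ring_units :: "'a::ring_1 set" where
  "ring_units = {u. \<exists>v. u * v = 1 \<and> v * u = 1}"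

lemma one_in_ring_units: "1 \<in> ring_units"
  by (auto simp: ring_units_def)

lemma ring_units_mult:
  assumes "u \<in> ring_units" "v \<in> ring_units"
  shows "u * v \<in> ring_units"
proof -
  obtain u' v' where "u * u' = 1" "u' * u = 1" "v * v' = 1" "v' * v = 1"
    using assms by (auto simp: ring_units_def)
  then have "u * (v * v') * u' = 1" "v' * (u' * u) * v = 1"
    by simp_all
  then have "(u * v) * (v' * u') = 1" "(v' * u') * (u * v) = 1"
    by (simp_all only: mult.assoc)
  then show ?thesis
    unfolding ring_units_def by blast
qed

text \<open>Left multiplication by \<open>u\<close> is injective, hence surjective by finiteness.
  This gives a right inverse, and cancelling \<open>u\<close> makes it two-sided.\<close>

lemma ring_units_if_left_regular:
  fixes u :: "'a::{ring_1,finite}"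
  assumes "\<And>z. u * z = 0 \<Longrightarrow> z = 0"
  shows "u \<in> ring_units"
proof -
  have inj: "inj (\<lambda>z. u * z)"
    by (rule injI) (metis assms eq_iff_diff_eq_0 right_diff_distrib)
  then have "surj (\<lambda>z. u * z)"
    by (intro finite_UNIV_inj_surj) auto
  then obtain v where v: "u * v = 1"
    by (metis surjD)
  have "u * (v * u) = u * 1"
    using v by (simp flip: mult.assoc)
  then have "v * u = 1"
    by (rule injD[OF inj])
  with v show ?thesis
    by (auto simp: ring_units_def)
qed

lemma left_ideal_genI: "r * x \<in> left_ideal_gen x"
  by (simp add: left_ideal_gen_def)

lemma left_ideal_gen_self: "x \<in> left_ideal_gen x"
  using left_ideal_genI[of 1 x] by simp

lemma left_ideal_gen_subset: "y \<in> left_ideal_gen x \<Longrightarrow> left_ideal_gen y \<subseteq> left_ideal_gen x"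
  by (auto simp: left_ideal_gen_def simp flip: mult.assoc)

text \<open>Moebius inversion on the lattice of subsets, done by induction from large
  \<open>K\<close> downwards: the count for the value \<open>K\<close> is the count for all
  supersets minus the counts for the strict ones.\<close>

lemma card_vimage_eq_if_card_superset_eq:
  fixes f :: "'s \<Rightarrow> 'b::finite set" and g :: "'t \<Rightarrow> 'b set"
  assumes "finite S" "finite T"
    and "\<And>K. card {s\<in>S. K \<subseteq> f s} = card {t\<in>T. K \<subseteq> g t}"
  shows "card {s\<in>S. f s = K} = card {t\<in>T. g t = K}"
proof (induction "card (- K)" arbitrary: K rule: less_induct)
  case less
  have split: "card {a\<in>A. K \<subseteq> h a} = card {a\<in>A. h a = K} + (\<Sum>L | K \<subset> L. card {a\<in>A. h a = L})"
    if "finite A" for A :: "'c set" and h :: "'c \<Rightarrow> 'b set"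
  proof -
    have "{a\<in>A. K \<subseteq> h a} = {a\<in>A. h a = K} \<union> (\<Union>L\<in>{L. K \<subset> L}. {a\<in>A. h a = L})"
      by auto
    then show ?thesis
      using that by (simp only:) (subst card_Un_disjoint, auto intro!: card_UN_disjoint)
  qed
  have "(\<Sum>L | K \<subset> L. card {s\<in>S. f s = L}) = (\<Sum>L | K \<subset> L. card {t\<in>T. g t = L})"
    by (intro sum.cong refl less) (auto intro: psubset_card_mono)
  then show ?case
    using assms(3)[of K] split[OF assms(1), of f] split[OF assms(2), of g] by linarith
qed

text \<open>
  The multipliers \<open>r\<close> with \<open>r y = x\<close> that kill a given set \<open>K\<close> are as many as those with
  \<open>r y = y\<close> that kill \<open>K\<close>. Hence the same holds for those with a prescribed annihilator, in
  particular for the units, and \<open>1\<close> is a unit with \<open>1 y = y\<close>.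
\<close>

lemma left_ideal_gen_eq_imp_unit_multiple:
  fixes x y :: "'a::{ring_1,finite}"
  assumes "left_ideal_gen x = left_ideal_gen y"
  obtains u where "u \<in> ring_units" "x = u * y"
proof -
  obtain a b where a: "x = a * y" and b: "y = b * x"
    using assms left_ideal_gen_self[of x] left_ideal_gen_self[of y]
    by (metis imageE left_ideal_gen_def)
  define ann where "ann r = {z. r * z = 0}" for r :: 'a
  define M where "M t = {r. r * y = t}" for t
  have "card {r\<in>M x. K \<subseteq> ann r} = card {r\<in>M y. K \<subseteq> ann r}" for K
  proof (cases "{r\<in>M x. K \<subseteq> ann r} = {} \<or> {r\<in>M y. K \<subseteq> ann r} = {}")
    case True
    \<comment> \<open>Left multiplication by \<open>b\<close> or \<open>a\<close> carries one set
      into the other and can only enlarge annihilators, so if one set is empty, both are.\<close>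
    have "b * r \<in> M y \<and> K \<subseteq> ann (b * r)" if "r \<in> M x" "K \<subseteq> ann r" for r
      using that b by (auto simp: M_def ann_def mult.assoc)
    moreover have "a * r \<in> M x \<and> K \<subseteq> ann (a * r)" if "r \<in> M y" "K \<subseteq> ann r" for r
      using that a by (auto simp: M_def ann_def mult.assoc)
    ultimately have "{r\<in>M x. K \<subseteq> ann r} = {}" "{r\<in>M y. K \<subseteq> ann r} = {}"
      using True by blast+
    then show ?thesis
      by (simp only: card.empty)
  next
    case False
    then obtain r s where "r \<in> M x" "K \<subseteq> ann r" "s \<in> M y" "K \<subseteq> ann s"
      by blast
    \<comment> \<open>Both sets are cosets of the additive group of multipliers that kill
      \<open>y\<close> and \<open>K\<close>, so a translation matches them.\<close>
    then have "bij_betw (\<lambda>q. q - r + s) {r\<in>M x. K \<subseteq> ann r} {r\<in>M y. K \<subseteq> ann r}"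
      by (intro bij_betw_byWitness[where f' = "\<lambda>q. q - s + r"])
        (auto simp: M_def ann_def subset_iff algebra_simps)
    then show ?thesis
      by (rule bij_betw_same_card)
  qed
  then have "card {r\<in>M x. ann r = {0}} = card {r\<in>M y. ann r = {0}}"
    by (intro card_vimage_eq_if_card_superset_eq) auto
  moreover have "1 \<in> {r\<in>M y. ann r = {0}}"
    by (auto simp: M_def ann_def)
  ultimately have "{r\<in>M x. ann r = {0}} \<noteq> {}"
    by (metis card.empty card_0_eq empty_iff finite)
  then obtain u where "u * y = x" "ann u = {0}"
    by (auto simp: M_def)
  then show ?thesis
    by (intro that[OF ring_units_if_left_regular]) (auto simp: ann_def)
qed

section \<open>Generating characters and the average over units\<close>

text \<open>The kernel contains no nonzero left ideal; it suffices to test principal ones.\<close>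

definition generating_character :: "('a::ring_1 \<Rightarrow> complex) \<Rightarrow> bool" where
  "generating_character \<psi> \<longleftrightarrow>
     additive_character \<psi> \<and> (\<forall>x. x \<noteq> 0 \<longrightarrow> (\<exists>r. \<psi> (r * x) \<noteq> 1))"

text \<open>The character \<open>\<Phi> 1\<close> works: \<open>\<Phi> x\<close> sends
  \<open>y\<close> to \<open>\<Phi> 1 (y * x)\<close>, so it is trivial if the left ideal of
  \<open>x\<close> lies in the kernel of \<open>\<Phi> 1\<close>, and injectivity of
  \<open>\<Phi>\<close> gives \<open>x = 0\<close>.\<close>

lemma frobenius_ring_generating_character:
  assumes "frobenius_ring TYPE('a::{ring_1,finite})"
  obtains \<psi> :: "'a::{ring_1,finite} \<Rightarrow> complex" where "generating_character \<psi>"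
proof -
  obtain \<Phi> :: "'a \<Rightarrow> 'a \<Rightarrow> complex"
    where bij: "bij_betw \<Phi> UNIV {\<psi>. additive_character \<psi>}"
      and act: "\<And>r x. \<Phi> (r * x) = (\<lambda>y. \<Phi> x (y * r))"
    using assms unfolding frobenius_ring_def by blast
  have char: "additive_character (\<Phi> 1)"
    using bij by (auto simp: bij_betw_def)
  have "\<Phi> 1 0 = 1"
    using char unfolding additive_character_def by (metis add_0 mult_cancel_right1)
  have "x = 0" if "\<forall>r. \<Phi> 1 (r * x) = 1" for x
  proof -
    have "\<Phi> x = \<Phi> 0"
      using act[of x 1] act[of 0 1] that \<open>\<Phi> 1 0 = 1\<close> by simp
    then show ?thesis
      using bij by (auto simp: bij_betw_def dest: injD)
  qed
  with char show ?thesis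
    by (intro that[of "\<Phi> 1"]) (auto simp: generating_character_def)
qed

definition unit_average :: "('a::{ring_1,finite} \<Rightarrow> complex) \<Rightarrow> 'a \<Rightarrow> complex" where
  "unit_average \<psi> x = (\<Sum>u\<in>ring_units. \<psi> (u * x)) / of_nat (card (ring_units :: 'a set))"

lemma unit_average_0:
  fixes \<psi> :: "'a::{ring_1,finite} \<Rightarrow> complex"
  assumes "additive_character \<psi>"
  shows "unit_average \<psi> 0 = 1"
proof -
  have "\<psi> 0 = 1"
    using assms unfolding additive_character_def by (metis add_0 mult_cancel_right1)
  moreover have "card (ring_units :: 'a set) \<noteq> 0"
    using one_in_ring_units by (metis card_0_eq empty_iff finite)
  ultimately show ?thesis
    by (simp add: unit_average_def)
qed

lemma unit_average_cong:
  fixes x y :: "'a::{ring_1,finite}"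
  assumes "left_ideal_gen x = left_ideal_gen y"
  shows "unit_average \<psi> x = unit_average \<psi> y"
proof -
  obtain v where v: "v \<in> ring_units" "x = v * y"
    using left_ideal_gen_eq_imp_unit_multiple[OF assms] .
  then obtain v' where v': "v * v' = 1" "v' * v = 1"
    by (auto simp: ring_units_def)
  then have "v' \<in> ring_units"
    by (auto simp: ring_units_def)
  have "bij_betw (\<lambda>u. u * v) ring_units ring_units"
    using v v' \<open>v' \<in> ring_units\<close>
    by (intro bij_betw_byWitness[where f' = "\<lambda>u. u * v'"]) (auto simp: mult.assoc ring_units_mult)
  then have "(\<Sum>u\<in>ring_units. \<psi> (u * v * y)) = (\<Sum>u\<in>ring_units. \<psi> (u * y))"
    by (rule sum.reindex_bij_betw)
  then show ?thesis
    by (simp add: unit_average_def v mult.assoc)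
qed

lemma sum_eq_0_if_translation_scales:
  fixes f :: "'b::ab_group_add \<Rightarrow> complex"
  assumes "finite D" "\<And>y. y \<in> D \<Longrightarrow> z + y \<in> D" "\<And>y. y \<in> D \<Longrightarrow> f (z + y) = k * f y" "k \<noteq> 1"
  shows "sum f D = 0"
proof -
  have "bij_betw ((+) z) D D"
    using assms(1,2) by (simp add: bij_betw_def inj_on_def endo_inj_surj image_subset_iff)
  then have "sum f D = (\<Sum>y\<in>D. f (z + y))"
    by (simp add: sum.reindex_bij_betw)
  also have "\<dots> = k * sum f D"
    by (simp add: assms(3) sum_distrib_left)
  finally show ?thesis
    using assms(4) by simp
qed

text \<open>The map \<open>p\<close> allows two uses: the identity on a principal left ideal, and a
  coordinate projection on a code.\<close>

lemma sum_unit_average_coset_eq_0: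
  fixes D :: "'b::ab_group_add set" and p :: "'b \<Rightarrow> 'a::{ring_1,finite}"
  assumes gen: "generating_character \<psi>" and "finite D"
    and add: "\<And>y z. p (y + z) = p y + p z"
    and D_add: "\<And>y z. y \<in> D \<Longrightarrow> z \<in> D \<Longrightarrow> y + z \<in> D"
    and D_mult: "\<And>r y. y \<in> D \<Longrightarrow> \<exists>z\<in>D. p z = r * p y"
    and nonzero: "y \<in> D" "p y \<noteq> 0"
  shows "(\<Sum>z\<in>D. unit_average \<psi> (x + p z)) = 0"
proof -
  have "(\<Sum>z\<in>D. \<psi> (u * (x + p z))) = 0" if u: "u \<in> ring_units" for u
  proof -
    obtain v where v: "u * v = 1"
      using u by (auto simp: ring_units_def)
    obtain r where r: "\<psi> (r * p y) \<noteq> 1"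
      using gen nonzero by (auto simp: generating_character_def)
    \<comment> \<open>The factor \<open>v\<close> cancels the unit \<open>u\<close>, so translation
      by \<open>z\<close> scales every summand by \<open>\<psi> (r * p y)\<close>, which is not
      1.\<close>
    obtain z where z: "z \<in> D" "p z = v * r * p y"
      using D_mult nonzero by blast
    have "u * p z = r * p y"
      using v z by (simp flip: mult.assoc)
    then have "\<psi> (u * (x + p (z + q))) = \<psi> (r * p y) * \<psi> (u * (x + p q))" for q
    proof -
      have "u * (x + p (z + q)) = r * p y + u * (x + p q)"
        using \<open>u * p z = r * p y\<close> by (simp add: add algebra_simps)
      then show ?thesis
        using gen by (simp add: generating_character_def additive_character_def)
    qed
    with r z D_add \<open>finite D\<close> show ?thesis
      by (intro sum_eq_0_if_translation_scales[where z = z and k = "\<psi> (r * p y)"]) auto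
  qed
  then have "(\<Sum>u\<in>ring_units. \<Sum>z\<in>D. \<psi> (u * (x + p z))) = 0"
    by simp
  then show ?thesis
    unfolding unit_average_def by (subst (asm) sum.swap) (simp flip: sum_divide_distrib)
qed

lemma sum_unit_average_left_ideal_gen:
  assumes "generating_character \<psi>" "x \<noteq> 0"
  shows "(\<Sum>y\<in>left_ideal_gen x. unit_average \<psi> y) = 0"
proof -
  have "(\<Sum>y\<in>left_ideal_gen x. unit_average \<psi> (0 + y)) = 0"
  proof (rule sum_unit_average_coset_eq_0[OF assms(1)])
    show "y + z \<in> left_ideal_gen x" if "y \<in> left_ideal_gen x" "z \<in> left_ideal_gen x" for y z
      using that by (auto simp: left_ideal_gen_def simp flip: distrib_right)
    show "\<exists>z\<in>left_ideal_gen x. z = r * y" if "y \<in> left_ideal_gen x" for r y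
      using that by (auto simp: left_ideal_gen_def simp flip: mult.assoc)
  qed (use assms left_ideal_gen_self in auto)
  then show ?thesis
    by simp
qed

text \<open>Elements of the ideal that do not generate it have smaller ideals, so by induction only
  the generators contribute, and on these \<open>h\<close> is constant.\<close>

lemma eq_0_if_sums_left_ideal_gen_eq_0:
  fixes h :: "'a::{ring_1,finite} \<Rightarrow> complex"
  assumes cong: "\<And>x y. left_ideal_gen x = left_ideal_gen y \<Longrightarrow> h x = h y"
    and sums: "\<And>x. (\<Sum>y\<in>left_ideal_gen x. h y) = 0"
  shows "h x = 0"
proof (induction "card (left_ideal_gen x)" arbitrary: x rule: less_induct)
  case less
  define G where "G = {y. left_ideal_gen y = left_ideal_gen x}"
  have "G \<subseteq> left_ideal_gen x"
    using left_ideal_gen_self by (auto simp: G_def)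
  have "h y = 0" if "y \<in> left_ideal_gen x - G" for y
  proof (rule less)
    show "card (left_ideal_gen y) < card (left_ideal_gen x)"
      using that left_ideal_gen_subset[of y x] by (auto simp: G_def intro!: psubset_card_mono)
  qed
  then have "(\<Sum>y\<in>left_ideal_gen x. h y) = (\<Sum>y\<in>G. h y)"
    using \<open>G \<subseteq> left_ideal_gen x\<close> by (intro sum.mono_neutral_right) auto
  also have "\<dots> = (\<Sum>y\<in>G. h x)"
    by (rule sum.cong) (auto simp: G_def intro: cong)
  finally have "of_nat (card G) * h x = 0"
    using sums by simp
  moreover have "card G \<noteq> 0"
    by (auto simp: G_def)
  ultimately show ?case
    by simp
qed

section \<open>Averages of a homogeneous weight\<close>

lemma homogeneous_weight_eq_unit_average:
  fixes w :: "'a::{ring_1,finite} \<Rightarrow> real"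
  assumes gen: "generating_character \<psi>" and hom: "homogeneous_weight \<gamma> w"
  shows "of_real (w x) = of_real \<gamma> * (1 - unit_average \<psi> x)"
proof -
  define h where "h x = of_real (w x) - of_real \<gamma> * (1 - unit_average \<psi> x)" for x
  \<comment> \<open>The averaging condition covers nonzero \<open>x\<close> only, so the zero ideal
    is treated separately.\<close>
  have h0: "h 0 = 0"
    using gen hom by (simp add: h_def unit_average_0 generating_character_def homogeneous_weight_def)
  have "h x = 0"
  proof (rule eq_0_if_sums_left_ideal_gen_eq_0)
    show "h x = h y" if "left_ideal_gen x = left_ideal_gen y" for x y
    proof -
      have "w x = w y"
        using that hom unfolding homogeneous_weight_def by blast
      then show ?thesis
        using unit_average_cong[OF that, of \<psi>] by (simp add: h_def)
    qed
    show "(\<Sum>y\<in>left_ideal_gen x. h y) = 0" for x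
    proof (cases "x = 0")
      case True
      then show ?thesis
        using h0 by (intro sum.neutral) (auto simp: left_ideal_gen_def)
    next
      case False
      have "(\<Sum>y\<in>left_ideal_gen x. h y) =
          of_real (\<Sum>y\<in>left_ideal_gen x. w y)
            - of_real \<gamma> * (of_nat (card (left_ideal_gen x)) - (\<Sum>y\<in>left_ideal_gen x. unit_average \<psi> y))"
        by (simp add: h_def sum_subtractf flip: sum_distrib_left)
      moreover have "(\<Sum>y\<in>left_ideal_gen x. w y) = \<gamma> * real (card (left_ideal_gen x))"
        using False hom unfolding homogeneous_weight_def by blast
      ultimately show ?thesis
        using sum_unit_average_left_ideal_gen[OF gen False] by simp
    qed
  qed
  then show ?thesis
    by (simp add: h_def)
qed

text \<open>Used with \<open>a\<close> a coordinate of a coset representative for cyclic codes, and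
  with \<open>a = 0\<close> for the whole code.\<close>

lemma sum_homogeneous_weight_coset:
  fixes w :: "'a::{ring_1,finite} \<Rightarrow> real" and D :: "('a ^ 'n) set"
  assumes frob: "frobenius_ring TYPE('a)" and hom: "homogeneous_weight \<gamma> w"
    and D: "left_linear_code D" "z \<in> D" "z $ i \<noteq> 0"
  shows "(\<Sum>y\<in>D. w (a + y $ i)) = \<gamma> * real (card D)"
proof -
  obtain \<psi> :: "'a \<Rightarrow> complex" where gen: "generating_character \<psi>"
    using frobenius_ring_generating_character[OF frob] .
  have "(\<Sum>y\<in>D. unit_average \<psi> (a + y $ i)) = 0"
  proof (rule sum_unit_average_coset_eq_0[where p = "\<lambda>y. y $ i", OF gen _ _ _ _ D(2,3)])
    show "\<exists>z\<in>D. z $ i = r * y $ i" if "y \<in> D" for r y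
      using that D(1) by (intro bexI[of _ "r *s y"]) (auto simp: left_linear_code_def)
  qed (use D(1) in \<open>auto simp: left_linear_code_def\<close>)
  then have "(\<Sum>y\<in>D. of_real \<gamma> * (1 - unit_average \<psi> (a + y $ i))) = of_real (\<gamma> * real (card D))"
    by (simp add: sum_subtractf flip: sum_distrib_left)
  then have "complex_of_real (\<Sum>y\<in>D. w (a + y $ i)) = of_real (\<gamma> * real (card D))"
    by (simp add: homogeneous_weight_eq_unit_average[OF gen hom])
  then show ?thesis
    by (simp only: of_real_eq_iff)
qed

section \<open>Cyclic submodules and their cosets\<close>

lemma left_linear_code_left_submodule_gen: "left_linear_code (left_submodule_gen c)"
proof -
  have "0 = 0 *s c"
    by (simp add: vec_eq_iff)
  then have "0 \<in> left_submodule_gen c"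
    unfolding left_submodule_gen_def by blast
  then show ?thesis
    by (auto simp: left_linear_code_def left_submodule_gen_def vector_smult_assoc)
      (metis rangeI vector_sadd_rdistrib)
qed

lemma left_submodule_gen_self: "c \<in> left_submodule_gen c"
  unfolding left_submodule_gen_def by (rule range_eqI[of _ _ 1]) (simp add: vec_eq_iff)

lemma left_submodule_gen_subset: "left_linear_code C \<Longrightarrow> c \<in> C \<Longrightarrow> left_submodule_gen c \<subseteq> C"
  by (auto simp: left_linear_code_def left_submodule_gen_def)

lemma left_linear_code_uminus:
  fixes x :: "'a::ring_1 ^ 'n"
  assumes "left_linear_code C" "x \<in> C"
  shows "- x \<in> C"
proof -
  have "- x = (- 1) *s x"
    by (simp add: vec_eq_iff)
  with assms show ?thesis
    by (simp add: left_linear_code_def)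
qed

text \<open>On the support of \<open>c\<close> each coordinate averages to \<gamma>; elsewhere all
  multiples of \<open>c\<close> vanish and \<open>x\<close> is unchanged.\<close>

lemma sum_word_weight_coset_left_submodule_gen:
  fixes w :: "'a::{ring_1,finite} \<Rightarrow> real" and c x :: "'a ^ 'n"
  assumes frob: "frobenius_ring TYPE('a)" and hom: "homogeneous_weight \<gamma> w"
  shows "(\<Sum>y\<in>left_submodule_gen c. word_weight w (x + y)) =
    real (card (left_submodule_gen c)) *
      (\<gamma> * real (hamming_weight c) + (\<Sum>i | c $ i = 0. w (x $ i)))"
proof -
  let ?D = "left_submodule_gen c"
  have "(\<Sum>y\<in>?D. word_weight w (x + y)) = (\<Sum>i\<in>UNIV. \<Sum>y\<in>?D. w (x $ i + y $ i))"
    unfolding word_weight_def by (subst sum.swap) simp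
  also have "\<dots> = (\<Sum>i | c $ i \<noteq> 0. \<Sum>y\<in>?D. w (x $ i + y $ i))
      + (\<Sum>i | c $ i = 0. \<Sum>y\<in>?D. w (x $ i + y $ i))"
    by (subst sum.union_disjoint[symmetric]) (auto intro: sum.cong)
  also have "(\<Sum>i | c $ i \<noteq> 0. \<Sum>y\<in>?D. w (x $ i + y $ i)) = (\<Sum>i | c $ i \<noteq> 0. \<gamma> * real (card ?D))"
    by (intro sum.cong refl sum_homogeneous_weight_coset[OF frob hom
          left_linear_code_left_submodule_gen left_submodule_gen_self]) auto
  also have "(\<Sum>i | c $ i = 0. \<Sum>y\<in>?D. w (x $ i + y $ i)) = (\<Sum>i | c $ i = 0. \<Sum>y\<in>?D. w (x $ i))"
    by (intro sum.cong refl) (auto simp: left_submodule_gen_def)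
  finally show ?thesis
    by (simp add: hamming_weight_def algebra_simps sum_distrib_left)
qed

lemma average_nonneg:
  fixes w :: "'a::{ring_1,finite} \<Rightarrow> real" and x :: "'a ^ 'n"
  assumes frob: "frobenius_ring TYPE('a)" and hom: "homogeneous_weight \<gamma> w"
    and "x \<noteq> 0" and less: "\<gamma> * real (hamming_weight x) < d"
    and ge: "\<And>y. y \<in> left_submodule_gen x \<Longrightarrow> y \<noteq> 0 \<Longrightarrow> d \<le> word_weight w y"
  shows "0 \<le> \<gamma>"
proof -
  let ?D = "left_submodule_gen x" and ?m = "\<gamma> * real (hamming_weight x)"
  have w0: "w 0 = 0"
    using hom by (simp add: homogeneous_weight_def)
  have "0 \<in> ?D"
    using left_linear_code_left_submodule_gen[of x] by (simp add: left_linear_code_def)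
  have "real (card ?D) * ?m = (\<Sum>y\<in>?D. word_weight w y)"
    using sum_word_weight_coset_left_submodule_gen[OF frob hom, where c = x and x = 0] by (simp add: w0)
  also have "\<dots> = (\<Sum>y\<in>?D - {0}. word_weight w y)"
    using \<open>0 \<in> ?D\<close> by (subst sum.remove[of _ 0]) (auto simp: word_weight_def w0)
  \<comment> \<open>Strictness needs a nonzero word in \<open>?D\<close>, and \<open>x\<close> is
    one.\<close>
  also have "\<dots> > (\<Sum>y\<in>?D - {0}. ?m)"
    using less ge left_submodule_gen_self[of x] \<open>x \<noteq> 0\<close> by (intro sum_strict_mono) force+
  finally have "real (card ?D - 1) * ?m < real (card ?D) * ?m"
    using \<open>0 \<in> ?D\<close> by simp
  moreover have "card ?D \<ge> 1"
    using \<open>0 \<in> ?D\<close> by (simp add: Suc_le_eq card_gt_0_iff) blast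
  ultimately have "0 < ?m"
    by (simp add: of_nat_diff algebra_simps)
  then show ?thesis
    by (simp add: zero_less_mult_iff)
qed

section \<open>The bound on the size of the code\<close>

theorem theorem1:
  fixes w :: "'a::{ring_1,finite} \<Rightarrow> real"
    and \<gamma> d :: real
    and C :: "('a ^ 'n) set"
    and c :: "'a ^ 'n"
  assumes "frobenius_ring TYPE('a)"
    and "homogeneous_weight \<gamma> w"
    and "left_linear_code C"
    and "C \<noteq> {0}"
    and "d = min_word_weight w C"
    and "\<gamma> * real CARD('n) < d"
    and "c \<in> C"
    and "\<gamma> * real (hamming_weight c) < d"
  shows "real (card C) \<le>
    real (card (left_submodule_gen c)) *
      ((d - \<gamma> * real (hamming_weight c)) / (d - \<gamma> * real CARD('n)))"
proof -
  note frob = assms(1) and hom = assms(2) and code = assms(3)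
  let ?D = "left_submodule_gen c" and ?l = "real (hamming_weight c)"
  define v where "v x = (\<Sum>i | c $ i = 0. w (x $ i))" for x :: "'a ^ 'n"
  have w0: "w 0 = 0"
    using hom by (simp add: homogeneous_weight_def)
  have "0 \<in> C"
    using code by (simp add: left_linear_code_def)
  have min: "d \<le> word_weight w x" if "x \<in> C" "x \<noteq> 0" for x
    unfolding assms(5) min_word_weight_def using that by (intro Min_le) auto
  have sub: "?D \<subseteq> C"
    using left_submodule_gen_subset code assms(7) .
  have "0 \<le> \<gamma>"
  proof (rule ccontr)
    assume neg: "\<not> 0 \<le> \<gamma>"
    \<comment> \<open>The word \<open>c\<close> itself serves unless it is zero; then
      \<open>0 < d\<close>, and a negative \<gamma> makes every nonzero word of \<open>C\<close>
      suitable.\<close>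
    obtain x where x: "x \<in> C" "x \<noteq> 0" "\<gamma> * real (hamming_weight x) < d"
    proof (cases "c = 0")
      case True
      obtain x where "x \<in> C" "x \<noteq> 0"
        using \<open>C \<noteq> {0}\<close> \<open>0 \<in> C\<close> by blast
      moreover have "\<gamma> * real (hamming_weight x) \<le> 0"
        using neg by (simp add: mult_le_0_iff)
      moreover have "0 < d"
        using assms(8) True by (simp add: hamming_weight_def)
      ultimately show ?thesis
        by (intro that) auto
    qed (use that assms in blast)
    then show False
      using average_nonneg[OF frob hom x(2,3)] min left_submodule_gen_subset[OF code x(1)] neg
      by blast
  qed
  have v_ge: "d - \<gamma> * ?l \<le> v x" if "x \<in> C - ?D" for x
  proof -
    \<comment> \<open>The coset of \<open>x\<close> lies in \<open>C\<close> and misses 0, because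
      \<open>x\<close> is not in \<open>?D\<close>.\<close>
    have "d \<le> word_weight w (x + y)" if y: "y \<in> ?D" for y
    proof (rule min)
      show "x + y \<in> C"
        using \<open>x \<in> C - ?D\<close> y sub code by (auto simp: left_linear_code_def)
      show "x + y \<noteq> 0"
        using \<open>x \<in> C - ?D\<close> left_linear_code_uminus[OF left_linear_code_left_submodule_gen y]
        by (auto simp: add_eq_0_iff2)
    qed
    then have "(\<Sum>y\<in>?D. d) \<le> (\<Sum>y\<in>?D. word_weight w (x + y))"
      by (rule sum_mono)
    then have "real (card ?D) * d \<le> real (card ?D) * (\<gamma> * ?l + v x)"
      by (simp add: sum_word_weight_coset_left_submodule_gen[OF frob hom] v_def)
    moreover have "0 < real (card ?D)"
      using left_submodule_gen_self[of c] by (simp add: card_gt_0_iff) blast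
    ultimately show ?thesis
      by simp
  qed
  have v_0: "v x = 0" if "x \<in> ?D" for x
    using that w0 by (auto simp: v_def left_submodule_gen_def)
  have "(real (card C) - real (card ?D)) * (d - \<gamma> * ?l) = (\<Sum>x\<in>C - ?D. d - \<gamma> * ?l)"
    using sub by (simp add: card_Diff_subset card_mono)
  also have "\<dots> \<le> (\<Sum>x\<in>C - ?D. v x)"
    by (rule sum_mono) (rule v_ge)
  also have "\<dots> = (\<Sum>x\<in>C. v x)"
    using sub v_0 by (intro sum.mono_neutral_left) auto
  also have "\<dots> = (\<Sum>i | c $ i = 0. \<Sum>x\<in>C. w (x $ i))"
    unfolding v_def by (rule sum.swap)
  also have "\<dots> \<le> (\<Sum>i | c $ i = 0. \<gamma> * real (card C))"
  proof (rule sum_mono)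
    fix i
    show "(\<Sum>x\<in>C. w (x $ i)) \<le> \<gamma> * real (card C)"
    proof (cases "\<exists>z\<in>C. z $ i \<noteq> 0")
      case True
      then show ?thesis
        using sum_homogeneous_weight_coset[OF frob hom code, of _ i 0] by auto
    next
      case False
      then show ?thesis
        using w0 \<open>0 \<le> \<gamma>\<close> by simp
    qed
  qed
  also have "\<dots> = (real CARD('n) - ?l) * (\<gamma> * real (card C))"
  proof -
    have "CARD('n) = card {i. c $ i = 0} + card {i. c $ i \<noteq> 0}"
      by (subst card_Un_disjoint[symmetric]) (auto intro: arg_cong[where f = card])
    then show ?thesis
      by (simp add: hamming_weight_def)
  qed
  \<comment> \<open>The terms \<open>\<gamma> * ?l * real (card C)\<close> on the two sides
    cancel.\<close>
  finally have "real (card C) * (d - \<gamma> * real CARD('n)) \<le> real (card ?D) * (d - \<gamma> * ?l)"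
    by (simp add: algebra_simps)
  then show ?thesis
    using assms(6) by (simp add: pos_le_divide_eq)
qed

end
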